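(* Let $\mathfrak{A},\mathfrak{B}$ be separable unital $C^*$-algebras, let $K\subset\mathfrak{A}$ and $L\subset\mathfrak{B}$ be compact sets generating $\mathfrak{A}$ and $\mathfrak{B}$ respectively, and let $\alpha:\mathfrak{A}\to\mathfrak{B}$ be a unital $*$-homomorphism. Then $\alpha$ is uniformly continuous in the sense that the mapping $$\alpha^*:(\operatorname{Rep}(\mathfrak{B}),d_L)\to(\operatorname{Rep}(\mathfrak{A}),d_K),\qquad \alpha^*(\pi)=\pi\circ\alpha,$$ is a uniformly continuous map between metric spaces.
   Context: A set $K\subset\mathfrak{A}$ generates the unital $C^*$-algebra $\mathfrak{A}$ if the smallest $C^*$-subalgebra of $\mathfrak{A}$ containing $K\cup\{1\}$ is $\mathfrak{A}$. $\operatorname{Rep}(\mathfrak{A})$ denotes the set of all unital $*$-representations $\pi:\mathfrak{A}\to B(\ell^2)$, with the metric $d_K(\pi,\pi')=\sup_{x\in K}\|\pi(x)-\pi'(x)\|$; similarly for $\mathfrak{B}$ and $L$. *)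

theory Defs
  imports "HOL-Analysis.Analysis"
begin

section \<open>Unital C*-algebras\<close>

text \<open>
  The class is built on \<^class>\<open>monoid_mult\<close> rather than \<^class>\<open>real_normed_algebra_1\<close> so that
  the zero algebra is not excluded.
\<close>

class cstar_algebra = banach + real_normed_algebra + monoid_mult +
  fixes scaleC :: "complex \<Rightarrow> 'a \<Rightarrow> 'a"  (infixr "*\<^sub>C" 75)
    and star :: "'a \<Rightarrow> 'a"
  assumes scaleR_scaleC: "r *\<^sub>R x = complex_of_real r *\<^sub>C x"
    and scaleC_add_right: "c *\<^sub>C (x + y) = c *\<^sub>C x + c *\<^sub>C y"
    and scaleC_add_left: "(c + d) *\<^sub>C x = c *\<^sub>C x + d *\<^sub>C x"
    and scaleC_scaleC: "c *\<^sub>C (d *\<^sub>C x) = (c * d) *\<^sub>C x"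
    and mult_scaleC_left: "(c *\<^sub>C x) * y = c *\<^sub>C (x * y)"
    and mult_scaleC_right: "x * (c *\<^sub>C y) = c *\<^sub>C (x * y)"
    and norm_scaleC: "norm (c *\<^sub>C x) = cmod c * norm x"
    and star_add: "star (x + y) = star x + star y"
    and star_scaleC: "star (c *\<^sub>C x) = cnj c *\<^sub>C star x"
    and star_mult: "star (x * y) = star y * star x"
    and star_star: "star (star x) = x"
    and norm_star_mult: "norm (star x * x) = (norm x)\<^sup>2"

definition unital_star_hom :: "('a::cstar_algebra \<Rightarrow> 'b::cstar_algebra) \<Rightarrow> bool"
  where "unital_star_hom f \<longleftrightarrow>
    (\<forall>x y. f (x + y) = f x + f y) \<and>
    (\<forall>c x. f (c *\<^sub>C x) = c *\<^sub>C f x) \<and>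
    (\<forall>x y. f (x * y) = f x * f y) \<and>
    (\<forall>x. f (star x) = star (f x)) \<and>
    f 1 = 1"

definition cstar_subalgebra :: "'a::cstar_algebra set \<Rightarrow> bool"
  where "cstar_subalgebra S \<longleftrightarrow>
    closed S \<and> 0 \<in> S \<and>
    (\<forall>x\<in>S. \<forall>y\<in>S. x + y \<in> S) \<and>
    (\<forall>c. \<forall>x\<in>S. c *\<^sub>C x \<in> S) \<and>
    (\<forall>x\<in>S. \<forall>y\<in>S. x * y \<in> S) \<and>
    (\<forall>x\<in>S. star x \<in> S)"

definition generates_cstar :: "'a::cstar_algebra set \<Rightarrow> bool"
  where "generates_cstar K \<longleftrightarrow> cstar_subalgebra hull (K \<union> {1}) = UNIV"


section \<open>The Hilbert space $\ell^2$\<close>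

typedef ell2 = "{x :: nat \<Rightarrow> complex. summable (\<lambda>n. (cmod (x n))\<^sup>2)}"
  morphisms ell2_nth Abs_ell2
  by (rule exI[of _ "\<lambda>_. 0"]) simp

setup_lifting type_definition_ell2

lemma ell2_eqI: "(\<And>n. ell2_nth x n = ell2_nth y n) \<Longrightarrow> x = y"
  by transfer auto

lemma summable_ell2: "summable (\<lambda>n. (cmod (ell2_nth x n))\<^sup>2)"
  by transfer simp

lemma summable_ell2_mult:
  fixes x y :: "nat \<Rightarrow> complex"
  assumes "summable (\<lambda>n. (cmod (x n))\<^sup>2)" "summable (\<lambda>n. (cmod (y n))\<^sup>2)"
  shows "summable (\<lambda>n. x n * cnj (y n))"
proof (rule summable_comparison_test')
  show "summable (\<lambda>n. (cmod (x n))\<^sup>2 + (cmod (y n))\<^sup>2)"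
    using assms by (rule summable_add)
  fix n
  have "cmod (x n) * cmod (y n) \<le> (cmod (x n))\<^sup>2 + (cmod (y n))\<^sup>2"
    using sum_squares_bound[of "cmod (x n)" "cmod (y n)"]
      norm_ge_zero[of "x n"] norm_ge_zero[of "y n"] mult_nonneg_nonneg[of "cmod (x n)" "cmod (y n)"]
    unfolding mult.assoc by linarith
  then show "norm (x n * cnj (y n)) \<le> (cmod (x n))\<^sup>2 + (cmod (y n))\<^sup>2"
    by (simp add: norm_mult)
qed

lemma summable_ell2_add:
  fixes x y :: "nat \<Rightarrow> complex"
  assumes "summable (\<lambda>n. (cmod (x n))\<^sup>2)" "summable (\<lambda>n. (cmod (y n))\<^sup>2)"
  shows "summable (\<lambda>n. (cmod (x n + y n))\<^sup>2)"
proof (rule summable_comparison_test')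
  show "summable (\<lambda>n. 2 * (cmod (x n))\<^sup>2 + 2 * (cmod (y n))\<^sup>2)"
    using assms by (intro summable_add summable_mult)
  fix n
  have "(cmod (x n + y n))\<^sup>2 \<le> (cmod (x n) + cmod (y n))\<^sup>2"
    by (intro power_mono norm_triangle_ineq) simp
  also have "\<dots> \<le> 2 * (cmod (x n))\<^sup>2 + 2 * (cmod (y n))\<^sup>2"
    using sum_squares_bound[of "cmod (x n)" "cmod (y n)"] by (simp add: power2_sum)
  finally show "norm ((cmod (x n + y n))\<^sup>2) \<le> 2 * (cmod (x n))\<^sup>2 + 2 * (cmod (y n))\<^sup>2"
    by simp
qed

lemma summable_ell2_scale:
  fixes x :: "nat \<Rightarrow> complex"
  shows "summable (\<lambda>n. (cmod (x n))\<^sup>2) \<Longrightarrow> summable (\<lambda>n. (cmod (c * x n))\<^sup>2)"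
  by (simp add: norm_mult power_mult_distrib summable_mult)

text \<open>The scalar product is linear in the first argument.\<close>

definition cinner :: "ell2 \<Rightarrow> ell2 \<Rightarrow> complex"
  where "cinner x y = (\<Sum>n. ell2_nth x n * cnj (ell2_nth y n))"

lemma summable_cinner: "summable (\<lambda>n. ell2_nth x n * cnj (ell2_nth y n))"
  by (intro summable_ell2_mult summable_ell2)

instantiation ell2 :: real_inner
begin

lift_definition zero_ell2 :: ell2 is "\<lambda>_. 0" by simp
lift_definition plus_ell2 :: "ell2 \<Rightarrow> ell2 \<Rightarrow> ell2" is "\<lambda>x y n. x n + y n"
  by (rule summable_ell2_add)
lift_definition uminus_ell2 :: "ell2 \<Rightarrow> ell2" is "\<lambda>x n. - x n" by simp
lift_definition minus_ell2 :: "ell2 \<Rightarrow> ell2 \<Rightarrow> ell2" is "\<lambda>x y n. x n - y n"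
  subgoal for x y using summable_ell2_add[of x "\<lambda>n. - y n"] by simp
  done
lift_definition scaleR_ell2 :: "real \<Rightarrow> ell2 \<Rightarrow> ell2" is "\<lambda>r x n. complex_of_real r * x n"
  by (rule summable_ell2_scale)

definition inner_ell2 :: "ell2 \<Rightarrow> ell2 \<Rightarrow> real"
  where "inner_ell2 x y = Re (cinner x y)"
definition norm_ell2 :: "ell2 \<Rightarrow> real"
  where "norm_ell2 x = sqrt (inner x x)"
definition dist_ell2 :: "ell2 \<Rightarrow> ell2 \<Rightarrow> real"
  where "dist_ell2 x y = norm (x - y)"
definition sgn_ell2 :: "ell2 \<Rightarrow> ell2"
  where "sgn_ell2 x = inverse (norm x) *\<^sub>R x"
definition uniformity_ell2 :: "(ell2 \<times> ell2) filter"
  where "uniformity_ell2 = (INF e\<in>{0<..}. principal {(x, y). dist x y < e})"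
definition open_ell2 :: "ell2 set \<Rightarrow> bool"
  where "open_ell2 U = (\<forall>x\<in>U. \<forall>\<^sub>F (x', y) in uniformity. x' = x \<longrightarrow> y \<in> U)"

lemma inner_ell2_suminf: "inner x y = (\<Sum>n. Re (ell2_nth x n * cnj (ell2_nth y n)))"
  unfolding inner_ell2_def cinner_def by (rule Re_suminf[OF summable_cinner])

lemma summable_inner_ell2: "summable (\<lambda>n. Re (ell2_nth x n * cnj (ell2_nth y n)))"
  by (rule summable_Re[OF summable_cinner])

lemma inner_ell2_self: "inner x x = (\<Sum>n. (cmod (ell2_nth x n))\<^sup>2)"
  unfolding inner_ell2_suminf
  by (rule suminf_cong) (simp add: cmod_power2 power2_eq_square[of "Re _"] power2_eq_square[of "Im _"])

instance
proof
  fix x y z :: ell2 and r s :: real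
  show "dist x y = norm (x - y)" by (rule dist_ell2_def)
  show "sgn x = inverse (norm x) *\<^sub>R x" by (rule sgn_ell2_def)
  show "(uniformity :: (ell2 \<times> ell2) filter) = (INF e\<in>{0<..}. principal {(x, y). dist x y < e})"
    by (rule uniformity_ell2_def)
  show "open U = (\<forall>x\<in>U. \<forall>\<^sub>F (x', y) in uniformity. x' = x \<longrightarrow> y \<in> U)" for U :: "ell2 set"
    by (rule open_ell2_def)
  show "x + y + z = x + (y + z)" by transfer (simp add: add.assoc)
  show "x + y = y + x" by transfer (simp add: add.commute)
  show "0 + x = x" by transfer simp
  show "- x + x = 0" by transfer simp
  show "x - y = x + - y" by transfer simp
  show "r *\<^sub>R (x + y) = r *\<^sub>R x + r *\<^sub>R y" by transfer (simp add: algebra_simps)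
  show "(r + s) *\<^sub>R x = r *\<^sub>R x + s *\<^sub>R x" by transfer (simp add: algebra_simps)
  show "r *\<^sub>R s *\<^sub>R x = (r * s) *\<^sub>R x" by transfer (simp add: mult.assoc)
  show "1 *\<^sub>R x = x" by transfer simp
  show "inner x y = inner y x"
    unfolding inner_ell2_suminf by (rule suminf_cong) (simp add: mult.commute)
  show "inner (x + y) z = inner x z + inner y z"
    unfolding inner_ell2_suminf
    by (subst suminf_add[OF summable_inner_ell2 summable_inner_ell2])
       (rule suminf_cong, simp add: plus_ell2.rep_eq algebra_simps)
  show "inner (r *\<^sub>R x) y = r * inner x y"
    unfolding inner_ell2_suminf
    by (subst suminf_mult[OF summable_inner_ell2, symmetric])
       (rule suminf_cong, simp add: scaleR_ell2.rep_eq algebra_simps)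
  show "0 \<le> inner x x"
    unfolding inner_ell2_self by (rule suminf_nonneg[OF summable_ell2]) simp
  show "inner x x = 0 \<longleftrightarrow> x = 0"
  proof
    assume "inner x x = 0"
    then have "\<forall>n. (cmod (ell2_nth x n))\<^sup>2 = 0"
      unfolding inner_ell2_self by (subst (asm) suminf_eq_zero_iff[OF summable_ell2]) auto
    then show "x = 0" by (intro ell2_eqI) (simp add: zero_ell2.rep_eq)
  next
    assume "x = 0"
    then show "inner x x = 0" by (simp add: inner_ell2_self zero_ell2.rep_eq)
  qed
  show "norm x = sqrt (inner x x)" by (rule norm_ell2_def)
qed

end

lemma norm_ell2_power2: "(norm x)\<^sup>2 = (\<Sum>n. (cmod (ell2_nth x n))\<^sup>2)"
  unfolding inner_ell2_self[symmetric] by (rule power2_norm_eq_inner)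

lemma sum_ell2_le_norm: "(\<Sum>n<N. (cmod (ell2_nth x n))\<^sup>2) \<le> (norm x)\<^sup>2"
  unfolding norm_ell2_power2 by (rule sum_le_suminf[OF summable_ell2]) auto

lemma cmod_ell2_nth_le: "cmod (ell2_nth x n) \<le> norm x"
proof -
  have "(cmod (ell2_nth x n))\<^sup>2 \<le> (\<Sum>k<Suc n. (cmod (ell2_nth x k))\<^sup>2)"
    by (simp add: sum_nonneg)
  also have "\<dots> \<le> (norm x)\<^sup>2" by (rule sum_ell2_le_norm)
  finally show ?thesis by (rule power2_le_imp_le) simp
qed

lemma ell2_bounded_sums:
  fixes f :: "nat \<Rightarrow> complex"
  assumes "\<And>N. (\<Sum>n<N. (cmod (f n))\<^sup>2) \<le> B"
  shows "summable (\<lambda>n. (cmod (f n))\<^sup>2)"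
  by (rule bounded_imp_summable[where B = B])
     (use assms[of "Suc _"] in \<open>simp_all add: lessThan_Suc_atMost\<close>)

instance ell2 :: banach
proof
  fix X :: "nat \<Rightarrow> ell2"
  assume X: "Cauchy X"
  have "Cauchy (\<lambda>m. ell2_nth (X m) n)" for n
  proof (rule metric_CauchyI)
    fix e :: real assume "0 < e"
    then obtain M where M: "\<And>m k. m \<ge> M \<Longrightarrow> k \<ge> M \<Longrightarrow> dist (X m) (X k) < e"
      using metric_CauchyD[OF X, of e] by blast
    have "dist (ell2_nth (X m) n) (ell2_nth (X k) n) < e" if "m \<ge> M" "k \<ge> M" for m k
      using cmod_ell2_nth_le[of "X m - X k" n] M[OF that]
      by (simp add: dist_norm minus_ell2.rep_eq)
    then show "\<exists>M. \<forall>m\<ge>M. \<forall>k\<ge>M. dist (ell2_nth (X m) n) (ell2_nth (X k) n) < e" by blast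
  qed
  then have "\<forall>n. \<exists>l. (\<lambda>m. ell2_nth (X m) n) \<longlonglongrightarrow> l"
    by (simp add: Cauchy_convergent_iff convergent_def)
  then obtain f where f: "\<And>n. (\<lambda>m. ell2_nth (X m) n) \<longlonglongrightarrow> f n" by metis
  have lim: "\<exists>M. \<forall>m\<ge>M. \<forall>N. (\<Sum>n<N. (cmod (ell2_nth (X m) n - f n))\<^sup>2) \<le> e\<^sup>2"
    if e: "0 < e" for e
  proof -
    obtain M where M: "\<And>m k. m \<ge> M \<Longrightarrow> k \<ge> M \<Longrightarrow> dist (X m) (X k) < e"
      using metric_CauchyD[OF X e] by blast
    have "(\<Sum>n<N. (cmod (ell2_nth (X m) n - f n))\<^sup>2) \<le> e\<^sup>2" if m: "m \<ge> M" for m N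
    proof (rule LIMSEQ_le_const2)
      show "(\<lambda>k. \<Sum>n<N. (cmod (ell2_nth (X m) n - ell2_nth (X k) n))\<^sup>2)
              \<longlonglongrightarrow> (\<Sum>n<N. (cmod (ell2_nth (X m) n - f n))\<^sup>2)"
        by (intro tendsto_intros f)
      have "(\<Sum>n<N. (cmod (ell2_nth (X m) n - ell2_nth (X k) n))\<^sup>2) \<le> e\<^sup>2" if "k \<ge> M" for k
      proof -
        have "(\<Sum>n<N. (cmod (ell2_nth (X m) n - ell2_nth (X k) n))\<^sup>2) \<le> (norm (X m - X k))\<^sup>2"
          using sum_ell2_le_norm[of "X m - X k" N] by (simp add: minus_ell2.rep_eq)
        also have "\<dots> \<le> e\<^sup>2"
          using M[OF m that] by (intro power_mono) (auto simp: dist_norm)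
        finally show ?thesis .
      qed
      then show "\<exists>K. \<forall>k\<ge>K. (\<Sum>n<N. (cmod (ell2_nth (X m) n - ell2_nth (X k) n))\<^sup>2) \<le> e\<^sup>2"
        by blast
    qed
    then show ?thesis by blast
  qed
  obtain M where M: "\<And>N. (\<Sum>n<N. (cmod (ell2_nth (X M) n - f n))\<^sup>2) \<le> 1"
    using lim[OF zero_less_one] by auto
  have "summable (\<lambda>n. (cmod (- (ell2_nth (X M) n - f n)))\<^sup>2)"
    using ell2_bounded_sums[OF M] unfolding norm_minus_cancel .
  from summable_ell2_add[OF summable_ell2[of "X M"] this]
  have fs: "summable (\<lambda>n. (cmod (f n))\<^sup>2)" by (simp only: minus_diff_eq add_diff_cancel_left' diff_add_cancel add.commute[of "ell2_nth _ _"])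
  define x where "x = Abs_ell2 f"
  have xn: "ell2_nth x n = f n" for n
    unfolding x_def by (subst Abs_ell2_inverse) (simp_all only: mem_Collect_eq fs)
  have "X \<longlonglongrightarrow> x"
  proof (rule metric_LIMSEQ_I)
    fix e :: real assume e: "0 < e"
    then obtain M where M: "\<And>m N. m \<ge> M \<Longrightarrow> (\<Sum>n<N. (cmod (ell2_nth (X m) n - f n))\<^sup>2) \<le> (e/2)\<^sup>2"
      using lim[OF half_gt_zero[OF e]] by blast
    have "dist (X m) x < e" if "m \<ge> M" for m
    proof -
      have "(norm (X m - x))\<^sup>2 \<le> (e/2)\<^sup>2"
        unfolding norm_ell2_power2
        by (rule suminf_le_const[OF summable_ell2])
           (simp only: minus_ell2.rep_eq xn M[OF that])
      then have "norm (X m - x) \<le> e/2" by (rule power2_le_imp_le) (use e in simp)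
      then show ?thesis using e by (simp add: dist_norm)
    qed
    then show "\<exists>M. \<forall>m\<ge>M. dist (X m) x < e" by blast
  qed
  then show "convergent X" by (auto simp: convergent_def)
qed

lift_definition ell2_scale :: "complex \<Rightarrow> ell2 \<Rightarrow> ell2" is "\<lambda>c x n. c * x n"
  by (rule summable_ell2_scale)

lemma ell2_scale_of_real: "ell2_scale (complex_of_real r) x = r *\<^sub>R x"
  by transfer simp

lemma ell2_scale_add_right: "ell2_scale c (x + y) = ell2_scale c x + ell2_scale c y"
  by transfer (simp add: algebra_simps)

lemma ell2_scale_add_left: "ell2_scale (c + d) x = ell2_scale c x + ell2_scale d x"
  by transfer (simp add: algebra_simps)

lemma ell2_scale_diff_right: "ell2_scale c (x - y) = ell2_scale c x - ell2_scale c y"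
  by transfer (simp add: algebra_simps)

lemma ell2_scale_scale: "ell2_scale c (ell2_scale d x) = ell2_scale (c * d) x"
  by transfer (simp add: mult.assoc)

lemma ell2_scale_zero [simp]: "ell2_scale c 0 = 0"
  by transfer simp

lemma ell2_scale_minus: "ell2_scale c (- x) = - ell2_scale c x"
  by transfer simp

lemma norm_ell2_scale: "norm (ell2_scale c x) = cmod c * norm x"
proof -
  have "(norm (ell2_scale c x))\<^sup>2 = (cmod c * norm x)\<^sup>2"
    unfolding norm_ell2_power2 power_mult_distrib
    by (simp add: ell2_scale.rep_eq norm_mult power_mult_distrib suminf_mult[OF summable_ell2])
  then show ?thesis by simp
qed

lemma bounded_linear_ell2_scale: "bounded_linear (ell2_scale c)"
  by (rule bounded_linear_intro[where K = "cmod c"])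
     (simp_all add: ell2_scale_add_right norm_ell2_scale ell2_scale_of_real[symmetric]
        ell2_scale_scale mult.commute)

lemma cinner_add_left: "cinner (x + y) z = cinner x z + cinner y z"
  unfolding cinner_def
  by (subst suminf_add[OF summable_cinner summable_cinner])
     (rule suminf_cong, simp add: plus_ell2.rep_eq algebra_simps)

lemma cinner_scale_left: "cinner (ell2_scale c x) y = c * cinner x y"
  unfolding cinner_def
  by (subst suminf_mult[OF summable_cinner, symmetric])
     (rule suminf_cong, simp add: ell2_scale.rep_eq algebra_simps)

lemma cinner_commute: "cinner x y = cnj (cinner y x)"
proof -
  have "(\<lambda>n. cnj (ell2_nth y n * cnj (ell2_nth x n))) sums cnj (cinner y x)"
    unfolding cinner_def sums_cnj by (rule summable_sums[OF summable_cinner])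
  then have "(\<lambda>n. ell2_nth x n * cnj (ell2_nth y n)) sums cnj (cinner y x)"
    by (simp add: mult.commute)
  then show ?thesis
    unfolding cinner_def[of x y] by (rule sums_unique[symmetric])
qed

lemma cinner_add_right: "cinner x (y + z) = cinner x y + cinner x z"
  by (subst (1 2 3) cinner_commute) (simp add: cinner_add_left)

lemma cinner_scale_right: "cinner x (ell2_scale c y) = cnj c * cinner x y"
  by (subst (1 2) cinner_commute) (simp add: cinner_scale_left)

lemma Re_cinner: "Re (cinner x y) = inner x y"
  by (simp add: inner_ell2_def)

lemma Im_cinner: "Im (cinner x y) = inner x (ell2_scale \<i> y)"
  by (simp add: inner_ell2_def cinner_scale_right)

lemma cinner_eqI: "(\<And>x. cinner x y = cinner x z) \<Longrightarrow> y = z"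
  by (metis Re_cinner inner_commute vector_eq_rdot)


lemma cmod_cinner_le: "cmod (cinner x y) \<le> norm x * norm y"
proof (cases "cinner x y = 0")
  case False
  let ?c = "cinner x y"
  have "(cmod ?c)\<^sup>2 = Re (cinner (ell2_scale (cnj ?c) x) y)"
    by (simp add: cinner_scale_left cmod_power2 power2_eq_square[of "Re _"] power2_eq_square[of "Im _"])
  also have "\<dots> \<le> norm (ell2_scale (cnj ?c) x) * norm y"
    unfolding Re_cinner by (rule norm_cauchy_schwarz)
  also have "\<dots> = cmod ?c * (norm x * norm y)"
    by (simp add: norm_ell2_scale)
  finally show ?thesis
    using False by (simp add: power2_eq_square)
qed simp

lift_definition ell2_unit :: "nat \<Rightarrow> ell2" is "\<lambda>n k. if k = n then 1 else 0"
  subgoal for n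
    by (rule summable_finite[of "{n}"]) auto
  done

fun ell2_comb :: "(nat \<Rightarrow> complex) \<Rightarrow> nat \<Rightarrow> ell2" where
  "ell2_comb a 0 = 0"
| "ell2_comb a (Suc N) = ell2_comb a N + ell2_scale (a N) (ell2_unit N)"

lemma ell2_nth_comb: "ell2_nth (ell2_comb a N) n = (if n < N then a n else 0)"
  by (induction N)
     (auto simp: zero_ell2.rep_eq plus_ell2.rep_eq ell2_scale.rep_eq ell2_unit.rep_eq less_Suc_eq)

lemma norm_ell2_comb: "(norm (ell2_comb a N))\<^sup>2 = (\<Sum>n<N. (cmod (a n))\<^sup>2)"
  unfolding norm_ell2_power2
  by (subst suminf_finite[of "{..<N}"]) (auto simp: ell2_nth_comb)

lemma ell2_comb_tendsto: "(\<lambda>N. ell2_comb (ell2_nth x) N) \<longlonglongrightarrow> x"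
proof -
  have eq: "(norm (x - ell2_comb (ell2_nth x) N))\<^sup>2 = (norm x)\<^sup>2 - (\<Sum>n<N. (cmod (ell2_nth x n))\<^sup>2)" for N
  proof -
    have "(norm (x - ell2_comb (ell2_nth x) N))\<^sup>2
        = (\<Sum>n. (cmod (ell2_nth x n))\<^sup>2 - (cmod (ell2_nth (ell2_comb (ell2_nth x) N) n))\<^sup>2)"
      unfolding norm_ell2_power2
      by (rule suminf_cong) (simp add: minus_ell2.rep_eq ell2_nth_comb)
    also have "\<dots> = (norm x)\<^sup>2 - (norm (ell2_comb (ell2_nth x) N))\<^sup>2"
      unfolding norm_ell2_power2 by (rule suminf_diff[symmetric]) (rule summable_ell2)+
    finally show ?thesis by (simp add: norm_ell2_comb)
  qed
  have "(\<lambda>N. (norm x)\<^sup>2 - (\<Sum>n<N. (cmod (ell2_nth x n))\<^sup>2)) \<longlonglongrightarrow> (norm x)\<^sup>2 - (norm x)\<^sup>2"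
    using summable_LIMSEQ[OF summable_ell2[of x]]
    by (intro tendsto_diff tendsto_const) (simp add: norm_ell2_power2)
  then have "(\<lambda>N. sqrt ((norm (x - ell2_comb (ell2_nth x) N))\<^sup>2)) \<longlonglongrightarrow> sqrt 0"
    unfolding eq by (intro tendsto_real_sqrt) simp
  then have "(\<lambda>N. dist (ell2_comb (ell2_nth x) N) x) \<longlonglongrightarrow> 0"
    by (simp add: dist_norm norm_minus_commute)
  then show ?thesis by (rule iffD2[OF tendsto_dist_iff])
qed

lemma ell2_riesz:
  assumes add: "\<And>x y. \<phi> (x + y) = \<phi> x + \<phi> y"
    and scale: "\<And>c x. \<phi> (ell2_scale c x) = c * \<phi> x"
    and bound: "\<And>x. cmod (\<phi> x) \<le> B * norm x"
  shows "\<exists>z. \<forall>x. \<phi> x = cinner x z"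
proof -
  have zero: "\<phi> 0 = 0" using scale[of 0 0] by simp
  have comb: "\<phi> (ell2_comb a N) = (\<Sum>n<N. a n * \<phi> (ell2_unit n))" for a N
    by (induction N) (simp_all add: zero add scale)
  have B: "(\<Sum>n<N. (cmod (cnj (\<phi> (ell2_unit n))))\<^sup>2) \<le> B\<^sup>2" for N
  proof -
    define a where "a n = cnj (\<phi> (ell2_unit n))" for n
    define S where "S = norm (ell2_comb a N)"
    have S: "S\<^sup>2 = (\<Sum>n<N. (cmod (a n))\<^sup>2)"
      unfolding S_def by (rule norm_ell2_comb)
    have "\<phi> (ell2_comb a N) = (\<Sum>n<N. complex_of_real ((cmod (a n))\<^sup>2))"
      unfolding comb by (rule sum.cong) (simp_all only: complex_norm_square a_def complex_cnj_cnj)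
    then have "\<phi> (ell2_comb a N) = complex_of_real (S\<^sup>2)"
      unfolding S by simp
    then have "S\<^sup>2 \<le> B * S"
      using bound[of "ell2_comb a N"] unfolding S_def[symmetric] by (simp add: norm_power)
    moreover have "0 \<le> S" by (simp add: S_def)
    ultimately have "S \<le> \<bar>B\<bar>"
      by (cases "S = 0") (auto simp: power2_eq_square)
    then have "S\<^sup>2 \<le> B\<^sup>2"
      using \<open>0 \<le> S\<close> by (metis abs_le_square_iff abs_of_nonneg)
    then show ?thesis unfolding S a_def .
  qed
  define z where "z = Abs_ell2 (\<lambda>n. cnj (\<phi> (ell2_unit n)))"
  have z: "ell2_nth z n = cnj (\<phi> (ell2_unit n))" for n
    unfolding z_def by (subst Abs_ell2_inverse) (use ell2_bounded_sums[OF B] in auto)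
  have "\<phi> x = cinner x z" for x
  proof (rule LIMSEQ_unique)
    have "bounded_linear \<phi>"
      by (rule bounded_linear_intro[where K = B])
         (simp_all add: add bound mult.commute[of _ B] scale ell2_scale_of_real[symmetric] scaleR_conv_of_real)
    then show "(\<lambda>N. \<phi> (ell2_comb (ell2_nth x) N)) \<longlonglongrightarrow> \<phi> x"
      by (rule bounded_linear.tendsto) (rule ell2_comb_tendsto)
    show "(\<lambda>N. \<phi> (ell2_comb (ell2_nth x) N)) \<longlonglongrightarrow> cinner x z"
      unfolding comb cinner_def
      using summable_LIMSEQ[OF summable_cinner[of x z]] by (simp add: z)
  qed
  then show ?thesis by blast
qed


section \<open>The C*-algebra $B(\ell^2)$\<close>

text \<open>Bounded complex-linear operators; \<^typ>\<open>'a \<Rightarrow>\<^sub>L 'b\<close> alone only asks for real linearity.\<close>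

typedef bop = "{T :: ell2 \<Rightarrow>\<^sub>L ell2. \<forall>c x. blinfun_apply T (ell2_scale c x) = ell2_scale c (blinfun_apply T x)}"
  morphisms bop_blinfun Abs_bop
  by (rule exI[of _ 0]) simp

setup_lifting type_definition_bop

definition bop_apply :: "bop \<Rightarrow> ell2 \<Rightarrow> ell2"
  where "bop_apply T = blinfun_apply (bop_blinfun T)"

lemma bop_eqI: "(\<And>x. bop_apply S x = bop_apply T x) \<Longrightarrow> S = T"
  unfolding bop_apply_def by transfer (simp add: blinfun_eqI)

lemma bop_apply_scale: "bop_apply T (ell2_scale c x) = ell2_scale c (bop_apply T x)"
  unfolding bop_apply_def by transfer simp

lemma bounded_linear_bop_apply: "bounded_linear (bop_apply T)"
  unfolding bop_apply_def by (rule blinfun.bounded_linear_right)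

instantiation bop :: real_normed_vector
begin

lift_definition zero_bop :: bop is 0 by simp
lift_definition plus_bop :: "bop \<Rightarrow> bop \<Rightarrow> bop" is "(+)"
  by (simp add: blinfun.add_left ell2_scale_add_right)
lift_definition uminus_bop :: "bop \<Rightarrow> bop" is uminus
  by (simp add: blinfun.minus_left ell2_scale_minus)
lift_definition minus_bop :: "bop \<Rightarrow> bop \<Rightarrow> bop" is "(-)"
  by (simp add: blinfun.diff_left ell2_scale_diff_right)
lift_definition scaleR_bop :: "real \<Rightarrow> bop \<Rightarrow> bop" is "(*\<^sub>R)"
  by (simp add: blinfun.scaleR_left ell2_scale_of_real[symmetric] ell2_scale_scale mult.commute)
lift_definition norm_bop :: "bop \<Rightarrow> real" is norm .

definition dist_bop :: "bop \<Rightarrow> bop \<Rightarrow> real"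
  where "dist_bop S T = norm (S - T)"
definition sgn_bop :: "bop \<Rightarrow> bop"
  where "sgn_bop T = inverse (norm T) *\<^sub>R T"
definition uniformity_bop :: "(bop \<times> bop) filter"
  where "uniformity_bop = (INF e\<in>{0<..}. principal {(x, y). dist x y < e})"
definition open_bop :: "bop set \<Rightarrow> bool"
  where "open_bop U = (\<forall>x\<in>U. \<forall>\<^sub>F (x', y) in uniformity. x' = x \<longrightarrow> y \<in> U)"

instance
proof
  fix x y z :: bop and r s :: real
  show "dist x y = norm (x - y)" by (rule dist_bop_def)
  show "sgn x = inverse (norm x) *\<^sub>R x" by (rule sgn_bop_def)
  show "(uniformity :: (bop \<times> bop) filter) = (INF e\<in>{0<..}. principal {(x, y). dist x y < e})"
    by (rule uniformity_bop_def)
  show "open U = (\<forall>x\<in>U. \<forall>\<^sub>F (x', y) in uniformity. x' = x \<longrightarrow> y \<in> U)" for U :: "bop set"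
    by (rule open_bop_def)
  show "x + y + z = x + (y + z)" by transfer (simp add: add.assoc)
  show "x + y = y + x" by transfer (simp add: add.commute)
  show "0 + x = x" by transfer simp
  show "- x + x = 0" by transfer simp
  show "x - y = x + - y" by transfer simp
  show "r *\<^sub>R (x + y) = r *\<^sub>R x + r *\<^sub>R y" by transfer (simp add: algebra_simps)
  show "(r + s) *\<^sub>R x = r *\<^sub>R x + s *\<^sub>R x" by transfer (simp add: algebra_simps)
  show "r *\<^sub>R s *\<^sub>R x = (r * s) *\<^sub>R x" by transfer simp
  show "1 *\<^sub>R x = x" by transfer simp
  show "norm x = 0 \<longleftrightarrow> x = 0" by transfer simp
  show "norm (x + y) \<le> norm x + norm y" by transfer (rule norm_triangle_ineq)
  show "norm (r *\<^sub>R x) = \<bar>r\<bar> * norm x" by transfer simp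
qed

end

lemma bop_apply_zero [simp]: "bop_apply 0 x = 0"
  by (simp add: bop_apply_def zero_bop.rep_eq)

lemma bop_apply_plus: "bop_apply (S + T) x = bop_apply S x + bop_apply T x"
  by (simp add: bop_apply_def plus_bop.rep_eq blinfun.add_left)

lemma bop_apply_scaleR: "bop_apply (r *\<^sub>R T) x = r *\<^sub>R bop_apply T x"
  by (simp add: bop_apply_def scaleR_bop.rep_eq blinfun.scaleR_left)

lemma norm_bop_apply: "norm (bop_apply T x) \<le> norm T * norm x"
  unfolding bop_apply_def norm_bop.rep_eq by (rule norm_blinfun)

lemma norm_bop_onorm: "norm T = onorm (bop_apply T)"
  by (simp add: bop_apply_def norm_bop.rep_eq norm_blinfun.rep_eq)

lemma norm_bop_le: "0 \<le> b \<Longrightarrow> (\<And>x. norm (bop_apply T x) \<le> b * norm x) \<Longrightarrow> norm T \<le> b"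
  unfolding bop_apply_def norm_bop.rep_eq by (rule norm_blinfun_bound)

instance bop :: banach
proof
  fix X :: "nat \<Rightarrow> bop"
  assume X: "Cauchy X"
  have d: "dist (bop_blinfun S) (bop_blinfun T) = dist S T" for S T
    by (simp add: dist_norm minus_bop.rep_eq norm_bop.rep_eq)
  have "Cauchy (\<lambda>n. bop_blinfun (X n))"
    using X unfolding Cauchy_def d .
  then obtain L where L: "(\<lambda>n. bop_blinfun (X n)) \<longlonglongrightarrow> L"
    by (auto simp: Cauchy_convergent_iff convergent_def)
  have app: "(\<lambda>n. blinfun_apply (bop_blinfun (X n)) x) \<longlonglongrightarrow> blinfun_apply L x" for x
    by (intro tendsto_intros L)
  have "blinfun_apply L (ell2_scale c x) = ell2_scale c (blinfun_apply L x)" for c x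
  proof (rule LIMSEQ_unique)
    show "(\<lambda>n. blinfun_apply (bop_blinfun (X n)) (ell2_scale c x)) \<longlonglongrightarrow> blinfun_apply L (ell2_scale c x)"
      by (rule app)
    have "(\<lambda>n. ell2_scale c (blinfun_apply (bop_blinfun (X n)) x)) \<longlonglongrightarrow> ell2_scale c (blinfun_apply L x)"
      by (rule bounded_linear.tendsto[OF bounded_linear_ell2_scale app])
    then show "(\<lambda>n. blinfun_apply (bop_blinfun (X n)) (ell2_scale c x)) \<longlonglongrightarrow> ell2_scale c (blinfun_apply L x)"
      using bop_blinfun by simp
  qed
  then have "bop_blinfun (Abs_bop L) = L"
    by (intro Abs_bop_inverse) simp
  then have "(\<lambda>n. dist (X n) (Abs_bop L)) \<longlonglongrightarrow> 0"
    using iffD1[OF tendsto_dist_iff L] by (simp add: d[symmetric])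
  then have "X \<longlonglongrightarrow> Abs_bop L" by (rule iffD2[OF tendsto_dist_iff])
  then show "convergent X" by (rule convergentI)
qed

definition is_adjoint :: "bop \<Rightarrow> bop \<Rightarrow> bool"
  where "is_adjoint T S \<longleftrightarrow> (\<forall>x y. cinner (bop_apply T x) y = cinner x (bop_apply S y))"

lemma is_adjoint_unique: "is_adjoint T S \<Longrightarrow> is_adjoint T S' \<Longrightarrow> S = S'"
  unfolding is_adjoint_def by (metis bop_eqI cinner_eqI)

lemma is_adjoint_sym: "is_adjoint T S \<Longrightarrow> is_adjoint S T"
  unfolding is_adjoint_def by (metis cinner_commute)

lemma bop_of_function:
  assumes "\<And>x y. f (x + y) = f x + f y" "\<And>c x. f (ell2_scale c x) = ell2_scale c (f x)"
    and "\<And>x. norm (f x) \<le> B * norm x"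
  shows "\<exists>T. bop_apply T = f"
proof -
  have f: "bounded_linear f"
    by (rule bounded_linear_intro[where K = B])
       (simp_all add: assms mult.commute[of _ B] ell2_scale_of_real[symmetric])
  have "bop_apply (Abs_bop (Blinfun f)) = f"
    unfolding bop_apply_def
    by (subst Abs_bop_inverse) (simp_all add: bounded_linear_Blinfun_apply[OF f] assms)
  then show ?thesis by blast
qed

lemma adjoint_exists: "\<exists>S. is_adjoint T S"
proof -
  interpret T: bounded_linear "bop_apply T" by (rule bounded_linear_bop_apply)
  have "\<exists>z. \<forall>x. cinner (bop_apply T x) y = cinner x z" for y
  proof (rule ell2_riesz)
    fix x
    have "cmod (cinner (bop_apply T x) y) \<le> norm (bop_apply T x) * norm y"
      by (rule cmod_cinner_le)
    also have "\<dots> \<le> (norm T * norm x) * norm y"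
      by (intro mult_right_mono norm_bop_apply) simp
    finally show "cmod (cinner (bop_apply T x) y) \<le> (norm T * norm y) * norm x"
      by (simp add: mult_ac)
  qed (simp_all add: T.add cinner_add_left bop_apply_scale cinner_scale_left)
  then obtain f where f: "\<And>x y. cinner (bop_apply T x) y = cinner x (f y)" by metis
  have "\<exists>S. bop_apply S = f"
  proof (rule bop_of_function)
    show "f (x + y) = f x + f y" for x y
      by (rule cinner_eqI) (simp add: f[symmetric] cinner_add_right)
    show "f (ell2_scale c x) = ell2_scale c (f x)" for c x
      by (rule cinner_eqI) (simp add: f[symmetric] cinner_scale_right)
    show "norm (f y) \<le> norm T * norm y" for y
    proof (cases "f y = 0")
      case False
      have "(norm (f y))\<^sup>2 = Re (cinner (f y) (f y))"
        by (simp add: Re_cinner power2_norm_eq_inner)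
      also have "\<dots> = inner (bop_apply T (f y)) y"
        by (simp add: f[symmetric] Re_cinner)
      also have "\<dots> \<le> norm (bop_apply T (f y)) * norm y"
        by (rule norm_cauchy_schwarz)
      also have "\<dots> \<le> (norm T * norm (f y)) * norm y"
        by (intro mult_right_mono norm_bop_apply) simp
      finally show ?thesis
        using False by (simp add: power2_eq_square mult_ac)
    qed simp
  qed
  then show ?thesis
    using f by (auto simp: is_adjoint_def)
qed

lemma ex1_adjoint: "\<exists>!S. is_adjoint T S"
  using adjoint_exists is_adjoint_unique by blast

instantiation bop :: cstar_algebra
begin

lift_definition one_bop :: bop is id_blinfun by simp
lift_definition times_bop :: "bop \<Rightarrow> bop \<Rightarrow> bop" is "(o\<^sub>L)" by simp

definition scaleC_bop :: "complex \<Rightarrow> bop \<Rightarrow> bop"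
  where "scaleC_bop c T = (THE S. \<forall>x. bop_apply S x = ell2_scale c (bop_apply T x))"

definition star_bop :: "bop \<Rightarrow> bop"
  where "star_bop T = (THE S. is_adjoint T S)"

lemma bop_apply_one: "bop_apply 1 x = x"
  by (simp add: bop_apply_def one_bop.rep_eq)

lemma bop_apply_times: "bop_apply (S * T) x = bop_apply S (bop_apply T x)"
  by (simp add: bop_apply_def times_bop.rep_eq)

lemma bop_apply_scaleC: "bop_apply (c *\<^sub>C T) x = ell2_scale c (bop_apply T x)"
proof -
  interpret T: bounded_linear "bop_apply T" by (rule bounded_linear_bop_apply)
  have "\<exists>S. bop_apply S = (\<lambda>x. ell2_scale c (bop_apply T x))"
  proof (rule bop_of_function)
    show "norm (ell2_scale c (bop_apply T x)) \<le> (cmod c * norm T) * norm x" for x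
      using mult_left_mono[OF norm_bop_apply[of T x] norm_ge_zero[of c]]
      by (simp add: norm_ell2_scale mult.assoc)
  qed (simp_all add: T.add ell2_scale_add_right bop_apply_scale ell2_scale_scale mult.commute)
  then have "\<exists>!S. \<forall>x. bop_apply S x = ell2_scale c (bop_apply T x)"
    by (metis bop_eqI)
  from theI'[OF this] show ?thesis
    unfolding scaleC_bop_def by blast
qed

lemma is_adjoint_star: "is_adjoint T (star T)"
  unfolding star_bop_def by (rule theI'[OF ex1_adjoint])

lemma cinner_star: "cinner (bop_apply T x) y = cinner x (bop_apply (star T) y)"
  using is_adjoint_star by (simp add: is_adjoint_def)

lemma star_bop_eqI: "is_adjoint T S \<Longrightarrow> star T = S"
  by (rule is_adjoint_unique[OF is_adjoint_star])

lemma norm_times_bop: "norm (S * T) \<le> norm S * norm (T :: bop)"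
proof (rule norm_bop_le)
  fix x
  have "norm (bop_apply (S * T) x) \<le> norm S * norm (bop_apply T x)"
    unfolding bop_apply_times by (rule norm_bop_apply)
  also have "\<dots> \<le> norm S * (norm T * norm x)"
    by (intro mult_left_mono norm_bop_apply) simp
  finally show "norm (bop_apply (S * T) x) \<le> norm S * norm T * norm x"
    by (simp add: mult.assoc)
qed simp

lemma norm_power2_le_star_times: "(norm T)\<^sup>2 \<le> norm (star T * T :: bop)"
proof -
  have "norm T \<le> sqrt (norm (star T * T))"
  proof (rule norm_bop_le)
    fix x
    have "(norm (bop_apply T x))\<^sup>2 = inner x (bop_apply (star T * T) x)"
      by (simp add: power2_norm_eq_inner Re_cinner[symmetric] cinner_star bop_apply_times)
    also have "\<dots> \<le> norm x * norm (bop_apply (star T * T) x)"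
      by (rule norm_cauchy_schwarz)
    also have "\<dots> \<le> norm x * (norm (star T * T) * norm x)"
      by (intro mult_left_mono norm_bop_apply) simp
    also have "\<dots> = (sqrt (norm (star T * T)) * norm x)\<^sup>2"
      by (simp add: power_mult_distrib power2_eq_square mult_ac)
    finally show "norm (bop_apply T x) \<le> sqrt (norm (star T * T)) * norm x"
      by (rule power2_le_imp_le) simp
  qed simp
  then show ?thesis
    using power_mono[of "norm T" "sqrt (norm (star T * T))" 2] by simp
qed

lemma star_star_bop: "star (star T) = (T :: bop)"
  by (rule star_bop_eqI[OF is_adjoint_sym[OF is_adjoint_star]])

lemma norm_star_bop_le: "norm T \<le> norm (star T :: bop)"
proof (cases "norm T = 0")
  case False
  have "norm T * norm T \<le> norm (star T) * norm T"
    using norm_power2_le_star_times[of T] norm_times_bop[of "star T" T]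
    by (simp add: power2_eq_square)
  then show ?thesis using False by (simp add: mult_le_cancel_right)
qed simp

instance
proof
  fix S T U :: bop and c d :: complex and r :: real
  have add: "bop_apply S (x + y) = bop_apply S x + bop_apply S y" for S x y
    using bounded_linear_bop_apply[of S] by (simp add: linear_simps)
  have scR: "bop_apply S (r *\<^sub>R x) = r *\<^sub>R bop_apply S x" for S x
    using bounded_linear_bop_apply[of S] by (simp add: linear_simps)
  note app = bop_apply_plus bop_apply_times bop_apply_one bop_apply_scaleC bop_apply_scaleR
    add scR bop_apply_scale
  show "S * T * U = S * (T * U)" by (rule bop_eqI) (simp add: app)
  show "(S + T) * U = S * U + T * U" by (rule bop_eqI) (simp add: app)
  show "S * (T + U) = S * T + S * U" by (rule bop_eqI) (simp add: app)
  show "r *\<^sub>R S * T = r *\<^sub>R (S * T)" by (rule bop_eqI) (simp add: app)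
  show "S * r *\<^sub>R T = r *\<^sub>R (S * T)" by (rule bop_eqI) (simp add: app)
  show "norm (S * T) \<le> norm S * norm T" by (rule norm_times_bop)
  show "1 * S = S" by (rule bop_eqI) (simp add: app)
  show "S * 1 = S" by (rule bop_eqI) (simp add: app)
  show "r *\<^sub>R S = complex_of_real r *\<^sub>C S"
    by (rule bop_eqI) (simp add: app ell2_scale_of_real)
  show "c *\<^sub>C (S + T) = c *\<^sub>C S + c *\<^sub>C T"
    by (rule bop_eqI) (simp add: app ell2_scale_add_right)
  show "(c + d) *\<^sub>C S = c *\<^sub>C S + d *\<^sub>C S"
    by (rule bop_eqI) (simp add: app ell2_scale_add_left)
  show "c *\<^sub>C d *\<^sub>C S = (c * d) *\<^sub>C S"
    by (rule bop_eqI) (simp add: app ell2_scale_scale)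
  show "(c *\<^sub>C S) * T = c *\<^sub>C (S * T)" by (rule bop_eqI) (simp add: app)
  show "S * (c *\<^sub>C T) = c *\<^sub>C (S * T)" by (rule bop_eqI) (simp add: app)
  show "norm (c *\<^sub>C S) = cmod c * norm S"
  proof -
    have le: "norm (c *\<^sub>C S) \<le> cmod c * norm S" for c and S :: bop
    proof (rule norm_bop_le)
      show "norm (bop_apply (c *\<^sub>C S) x) \<le> cmod c * norm S * norm x" for x
        using mult_left_mono[OF norm_bop_apply[of S x] norm_ge_zero[of c]]
        by (simp add: app norm_ell2_scale mult.assoc)
    qed simp
    show ?thesis
    proof (cases "c = 0")
      case True
      then show ?thesis using le[of 0 S] by simp
    next
      case False
      have "inverse c *\<^sub>C c *\<^sub>C S = S"
        using False ell2_scale_of_real[of 1]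
        by (intro bop_eqI) (simp add: app ell2_scale_scale)
      then have "norm S \<le> inverse (cmod c) * norm (c *\<^sub>C S)"
        using le[of "inverse c" "c *\<^sub>C S"] by (simp add: norm_inverse)
      then have "cmod c * norm S \<le> norm (c *\<^sub>C S)"
        using False by (simp add: field_simps)
      then show ?thesis using le[of c S] by simp
    qed
  qed
  show "star (S + T) = star S + star T"
    by (rule star_bop_eqI)
       (simp add: is_adjoint_def app cinner_add_left cinner_add_right cinner_star)
  show "star (c *\<^sub>C S) = cnj c *\<^sub>C star S"
    by (rule star_bop_eqI)
       (simp add: is_adjoint_def app cinner_scale_left cinner_scale_right cinner_star)
  show "star (S * T) = star T * star S"
    by (rule star_bop_eqI) (simp add: is_adjoint_def app cinner_star)
  show "star (star S) = S" by (rule star_star_bop)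
  show "norm (star S * S) = (norm S)\<^sup>2"
  proof (rule antisym)
    have "norm (star S) \<le> norm S"
      using norm_star_bop_le[of "star S"] by (simp add: star_star_bop)
    then show "norm (star S * S) \<le> (norm S)\<^sup>2"
      using norm_times_bop[of "star S" S] mult_right_mono[of "norm (star S)" "norm S" "norm S"]
      by (simp add: power2_eq_square)
  qed (rule norm_power2_le_star_times)
qed

end


section \<open>The space of representations\<close>

definition Rep :: "('a::cstar_algebra \<Rightarrow> bop) set"
  where "Rep = {\<pi>. unital_star_hom \<pi>}"

text \<open>
  Inserting \<^term>\<open>0::real\<close> only affects \<^term>\<open>K = {}\<close>, where the supremum is to be \<open>0\<close>.
  Outside \<^const>\<open>Rep\<close> the value is \<open>0\<close>, as \<^locale>\<open>Metric_space\<close> asks for a nonnegative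
  symmetric function on the whole type.
\<close>

definition rep_dist :: "'a::cstar_algebra set \<Rightarrow> ('a \<Rightarrow> bop) \<Rightarrow> ('a \<Rightarrow> bop) \<Rightarrow> real"
  where "rep_dist K \<pi> \<pi>' =
    (if \<pi> \<in> Rep \<and> \<pi>' \<in> Rep then Sup (insert 0 ((\<lambda>x. norm (\<pi> x - \<pi>' x)) ` K)) else 0)"

end

theory Submission
  imports Defs
begin

text \<open>
  Unital \<open>*\<close>-representations on \<open>\<ell>\<^sup>2\<close> are contractive, hence uniformly equicontinuous as maps
  on the algebra. For a compact generating set \<open>K\<close> this makes the uniform structure of \<open>d\<^sub>K\<close>
  independent of \<open>K\<close>: for sequences of representations, \<open>d\<^sub>K(p\<^sub>n, q\<^sub>n) \<rightarrow> 0\<close> holds if and only if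
  \<open>p\<^sub>n(x) - q\<^sub>n(x) \<rightarrow> 0\<close> for every \<open>x\<close> in the whole algebra (\<open>rep_dist_tendsto_0_iff\<close>). In one
  direction, the set of all \<open>x\<close> with \<open>p\<^sub>n(x) - q\<^sub>n(x) \<rightarrow> 0\<close> is a C*-subalgebra; it contains \<open>1\<close>,
  and \<open>K\<close> if \<open>d\<^sub>K(p\<^sub>n, q\<^sub>n) \<rightarrow> 0\<close>. In the other direction, pointwise convergence of an
  equicontinuous sequence is uniform on a compact set. The condition on all \<open>x\<close> is plainly
  inherited by \<open>p\<^sub>n \<circ> \<alpha>\<close> and \<open>q\<^sub>n \<circ> \<alpha>\<close>, and uniform continuity of a map between metric spaces can
  be tested on pairs of sequences whose distance tends to \<open>0\<close>.

  Contractivity is proved without the spectral radius formula. Write \<open>S = \<pi>(x)\<close> and suppose that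
  \<open>\<parallel>x\<parallel> < \<parallel>S\<parallel>\<close>. Then \<open>\<parallel>S\<parallel>\<^sup>2 - x\<^sup>*x\<close> has a left inverse given by a Neumann series, and \<open>\<pi>\<close> maps
  it to a left inverse of \<open>\<parallel>S\<parallel>\<^sup>2 - S\<^sup>*S\<close>. But no such operator exists, because the vectors at
  which \<open>S\<close> nearly attains its norm are approximate eigenvectors of \<open>S\<^sup>*S\<close> for the eigenvalue
  \<open>\<parallel>S\<parallel>\<^sup>2\<close>.
\<close>

section \<open>Contractivity of representations\<close>

lemma norm_star: "norm (star x) = norm (x :: 'a::cstar_algebra)"
proof -
  have le: "norm y \<le> norm (star y)" for y :: 'a
  proof (cases "norm y = 0")
    case False
    have "norm y * norm y \<le> norm (star y) * norm y"
      using norm_mult_ineq[of "star y" y] norm_star_mult[of y] by (simp add: power2_eq_square)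
    then show ?thesis using False by (simp add: mult_le_cancel_right)
  qed simp
  show ?thesis using le[of x] le[of "star x"] by (simp add: star_star)
qed

lemma norm_power_le_cstar: "norm (x ^ Suc n) \<le> norm (x :: 'a::cstar_algebra) ^ Suc n"
proof (induction n)
  case (Suc n)
  have "norm (x ^ Suc (Suc n)) \<le> norm x * norm (x ^ Suc n)"
    by (subst power_Suc) (rule norm_mult_ineq)
  also have "\<dots> \<le> norm x * norm x ^ Suc n"
    by (intro mult_left_mono Suc.IH) simp
  finally show ?case by simp
qed simp

text \<open>The left inverse is the Neumann series \<open>1 + h + h\<^sup>2 + \<dots>\<close>.\<close>

lemma left_inverse_one_minus:
  fixes h :: "'a::cstar_algebra"
  assumes "norm h < 1"
  shows "\<exists>u. u * (1 - h) = 1"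
proof
  have "summable (\<lambda>n. norm h ^ Suc n)"
    using summable_geometric[of "norm h"] assms by (simp only: summable_Suc_iff) simp
  then have "summable (\<lambda>n. h ^ Suc n)"
    by (rule summable_comparison_test') (rule norm_power_le_cstar)
  then have sum: "summable (\<lambda>n. h ^ n)"
    by (simp only: summable_Suc_iff)
  have "(\<lambda>n. h ^ n - h ^ Suc n) sums (h ^ 0 - 0)"
    by (rule telescope_sums'[OF summable_LIMSEQ_zero[OF sum]])
  then have "(\<Sum>n. h ^ n * (1 - h)) = 1"
    using sums_unique by (fastforce simp: right_diff_distrib power_commutes)
  then show "(\<Sum>n. h ^ n) * (1 - h) = 1"
    using suminf_mult2[OF sum, of "1 - h"] by simp
qed

lemma bop_apply_minus: "bop_apply (S - T) x = bop_apply S x - bop_apply T x"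
  by (metis bop_apply_plus diff_add_cancel eq_diff_eq)

text \<open>
  With \<open>m = \<parallel>S\<parallel>\<^sup>2\<close> and \<open>T = m - S\<^sup>*S\<close>, expanding the square gives
  \<open>\<parallel>T x\<parallel>\<^sup>2 \<le> 2 m (m \<parallel>x\<parallel>\<^sup>2 - \<parallel>S x\<parallel>\<^sup>2)\<close>. A left inverse would bound \<open>T\<close> from below, so that
  \<open>m \<parallel>x\<parallel>\<^sup>2 - \<parallel>S x\<parallel>\<^sup>2 \<ge> \<delta> \<parallel>x\<parallel>\<^sup>2\<close> for some \<open>\<delta> > 0\<close>, contradicting that \<open>\<parallel>S\<parallel>\<close> is the least bound
  of \<open>S\<close>.
\<close>

lemma no_left_inverse_norm_square_minus_star_mult:
  fixes S U :: bop
  assumes "S \<noteq> 0"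
  shows "U * ((norm S)\<^sup>2 *\<^sub>R 1 - star S * S) \<noteq> 1"
proof
  define m where "m = (norm S)\<^sup>2"
  define T where "T = m *\<^sub>R 1 - star S * S"
  assume "U * ((norm S)\<^sup>2 *\<^sub>R 1 - star S * S) = 1"
  then have UT: "bop_apply U (bop_apply T x) = x" for x
    unfolding T_def m_def by (simp flip: bop_apply_times add: bop_apply_one)
  have m: "m > 0" using assms by (simp add: m_def)
  have T_le: "(norm (bop_apply T x))\<^sup>2 \<le> 2 * m * (m * (norm x)\<^sup>2 - (norm (bop_apply S x))\<^sup>2)" for x
  proof -
    define y where "y = bop_apply (star S) (bop_apply S x)"
    have Tx: "bop_apply T x = m *\<^sub>R x - y"
      by (simp add: T_def y_def bop_apply_minus bop_apply_scaleR bop_apply_one bop_apply_times)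
    have inner: "inner x y = (norm (bop_apply S x))\<^sup>2"
      by (simp add: y_def power2_norm_eq_inner Re_cinner[symmetric] cinner_star)
    have "norm y \<le> norm S * norm (bop_apply S x)"
      using norm_bop_apply[of "star S" "bop_apply S x"] by (simp add: y_def norm_star)
    also have "\<dots> \<le> norm S * (norm S * norm x)"
      by (intro mult_left_mono norm_bop_apply) simp
    finally have "norm y \<le> m * norm x" by (simp add: m_def power2_eq_square)
    then have y: "(norm y)\<^sup>2 \<le> m\<^sup>2 * (norm x)\<^sup>2"
      using power_mono[of "norm y" "m * norm x" 2] by (simp add: power_mult_distrib)
    have "(norm (m *\<^sub>R x - y))\<^sup>2 = m\<^sup>2 * (norm x)\<^sup>2 - 2 * m * inner x y + (norm y)\<^sup>2"
      unfolding power2_norm_eq_inner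
      by (simp add: inner_diff inner_commute algebra_simps power2_eq_square)
    then show ?thesis
      using y by (simp add: Tx inner algebra_simps power2_eq_square)
  qed
  \<comment> \<open>\<open>1 / C\<close> is the \<open>\<delta>\<close> above; adding \<open>1\<close> to \<open>\<parallel>U\<parallel>\<^sup>2\<close> makes \<open>C\<close> visibly positive.\<close>
  define C where "C = 2 * m * ((norm U)\<^sup>2 + 1)"
  have C: "C > 0" using m by (simp add: C_def add_nonneg_pos)
  have bound: "(norm (bop_apply S x))\<^sup>2 \<le> (m - 1 / C) * (norm x)\<^sup>2" for x
  proof -
    have "norm x \<le> norm U * norm (bop_apply T x)"
      using norm_bop_apply[of U "bop_apply T x"] by (simp add: UT)
    then have "(norm x)\<^sup>2 \<le> (norm U)\<^sup>2 * (norm (bop_apply T x))\<^sup>2"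
      using power_mono[of "norm x" _ 2] by (fastforce simp: power_mult_distrib)
    also have "\<dots> \<le> ((norm U)\<^sup>2 + 1) * (norm (bop_apply T x))\<^sup>2"
      by (intro mult_right_mono) simp_all
    also have "\<dots> \<le> ((norm U)\<^sup>2 + 1) * (2 * m * (m * (norm x)\<^sup>2 - (norm (bop_apply S x))\<^sup>2))"
      by (intro mult_left_mono T_le) simp
    finally have "(norm x)\<^sup>2 \<le> C * (m * (norm x)\<^sup>2 - (norm (bop_apply S x))\<^sup>2)"
      by (simp only: C_def mult_ac)
    then show ?thesis using C by (simp add: field_simps)
  qed
  define b where "b = max 0 (m - 1 / C)"
  have "norm S \<le> sqrt b"
  proof (rule norm_bop_le)
    fix x
    have "(norm (bop_apply S x))\<^sup>2 \<le> b * (norm x)\<^sup>2"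
      using bound[of x] by (rule order_trans) (auto intro: mult_right_mono simp: b_def)
    also have "\<dots> = (sqrt b * norm x)\<^sup>2"
      by (simp add: power_mult_distrib b_def)
    finally show "norm (bop_apply S x) \<le> sqrt b * norm x"
      by (rule power2_le_imp_le) (simp add: b_def)
  qed (simp add: b_def)
  then have "m \<le> b"
    using power_mono[of "norm S" "sqrt b" 2] by (simp add: m_def b_def)
  moreover have "b < m" using m C by (simp add: b_def)
  ultimately show False by simp
qed

lemma unital_star_hom_diff:
  assumes "unital_star_hom f"
  shows "f (x - y) = f x - f y"
proof -
  have "f (x - y) + f y = f x"
    using assms unfolding unital_star_hom_def by (metis diff_add_cancel)
  then show ?thesis by (simp add: eq_diff_eq)
qed

lemma unital_star_hom_scaleR:
  assumes "unital_star_hom f"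
  shows "f (r *\<^sub>R x) = r *\<^sub>R f x"
  using assms by (simp add: unital_star_hom_def scaleR_scaleC)

lemma unital_star_hom_compose:
  "unital_star_hom f \<Longrightarrow> unital_star_hom g \<Longrightarrow> unital_star_hom (f \<circ> g)"
  by (simp add: unital_star_hom_def)

text \<open>
  The algebraic properties of \<open>\<pi>\<close> suffice to carry a left inverse of \<open>\<parallel>\<pi>(x)\<parallel>\<^sup>2 - x\<^sup>*x\<close>, which
  exists if \<open>\<parallel>x\<parallel> < \<parallel>\<pi>(x)\<parallel>\<close>, over to \<open>B(\<ell>\<^sup>2)\<close>, where there is none.
\<close>

lemma Rep_norm_le:
  assumes "\<pi> \<in> Rep"
  shows "norm (\<pi> x) \<le> norm x"
proof (rule ccontr)
  assume "\<not> norm (\<pi> x) \<le> norm x"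
  then have less: "norm x < norm (\<pi> x)" by simp
  have hom: "unital_star_hom \<pi>" using assms by (simp add: Rep_def)
  define s where "s = (norm (\<pi> x))\<^sup>2"
  have s: "(norm x)\<^sup>2 < s" using less by (simp add: s_def power_strict_mono)
  then have s0: "s > 0" by (rule le_less_trans[rotated]) simp
  define h where "h = inverse s *\<^sub>R (star x * x)"
  have "norm h < 1"
    using s s0 by (simp add: h_def norm_star_mult field_simps)
  then obtain u where u: "u * (1 - h) = 1"
    using left_inverse_one_minus by blast
  have "\<pi> u * (1 - \<pi> h) = 1"
  proof -
    have "\<pi> u * (1 - \<pi> h) = \<pi> (u * (1 - h))"
      using hom unital_star_hom_diff[OF hom, of 1 h] by (simp add: unital_star_hom_def)
    then show ?thesis using hom by (simp add: u unital_star_hom_def)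
  qed
  moreover have "\<pi> h = inverse s *\<^sub>R (star (\<pi> x) * \<pi> x)"
    using hom by (simp add: h_def unital_star_hom_scaleR) (simp add: unital_star_hom_def)
  ultimately have "(inverse s *\<^sub>R \<pi> u) * (s *\<^sub>R 1 - star (\<pi> x) * \<pi> x) = 1"
    using s0 by (simp add: right_diff_distrib)
  moreover have "\<pi> x \<noteq> 0" using less by auto
  ultimately show False
    using no_left_inverse_norm_square_minus_star_mult unfolding s_def by blast
qed

text \<open>Uniform equicontinuity, in the form of comparing differences at two points.\<close>

lemma Rep_diff_le:
  assumes "\<pi> \<in> Rep" "\<pi>' \<in> Rep"
  shows "norm (\<pi> x - \<pi>' x) \<le> norm (\<pi> y - \<pi>' y) + 2 * dist x y"
proof -
  have "\<pi> x - \<pi>' x = (\<pi> y - \<pi>' y) + \<pi> (x - y) - \<pi>' (x - y)"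
    using assms by (simp add: Rep_def unital_star_hom_diff)
  then have "norm (\<pi> x - \<pi>' x) \<le> norm (\<pi> y - \<pi>' y) + norm (\<pi> (x - y)) + norm (\<pi>' (x - y))"
    by (metis norm_triangle_ineq norm_triangle_ineq4 add_right_mono order_trans)
  then show ?thesis
    using Rep_norm_le[OF assms(1), of "x - y"] Rep_norm_le[OF assms(2), of "x - y"]
    by (simp add: dist_norm)
qed


section \<open>The distance of representations\<close>

lemma rep_dist_bdd_above:
  assumes "compact K" "\<pi> \<in> Rep" "\<pi>' \<in> Rep"
  shows "bdd_above (insert 0 ((\<lambda>x. norm (\<pi> x - \<pi>' x)) ` K))"
proof -
  obtain B where B: "\<And>x. x \<in> K \<Longrightarrow> norm x \<le> B"
    using compact_imp_bounded[OF assms(1)] unfolding bounded_iff by blast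
  have "norm (\<pi> x - \<pi>' x) \<le> 2 * B" if "x \<in> K" for x
    using norm_triangle_ineq4[of "\<pi> x" "\<pi>' x"] Rep_norm_le[OF assms(2), of x]
      Rep_norm_le[OF assms(3), of x] B[OF that] by linarith
  then have "bdd_above ((\<lambda>x. norm (\<pi> x - \<pi>' x)) ` K)"
    by (rule bdd_aboveI2)
  then show ?thesis by simp
qed

lemma norm_diff_le_rep_dist:
  assumes "compact K" "\<pi> \<in> Rep" "\<pi>' \<in> Rep" "x \<in> K"
  shows "norm (\<pi> x - \<pi>' x) \<le> rep_dist K \<pi> \<pi>'"
proof -
  have "norm (\<pi> x - \<pi>' x) \<in> insert 0 ((\<lambda>x. norm (\<pi> x - \<pi>' x)) ` K)"
    using assms(4) by blast
  from cSup_upper[OF this rep_dist_bdd_above[OF assms(1-3)]] show ?thesis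
    using assms(2,3) by (simp only: rep_dist_def) simp
qed

lemma rep_dist_nonneg:
  assumes "compact K"
  shows "0 \<le> rep_dist K \<pi> \<pi>'"
proof (cases "\<pi> \<in> Rep \<and> \<pi>' \<in> Rep")
  case True
  have "0 \<in> insert 0 ((\<lambda>x. norm (\<pi> x - \<pi>' x)) ` K)" by (rule insertI1)
  from cSup_upper[OF this rep_dist_bdd_above] show ?thesis
    using True assms by (simp only: rep_dist_def) simp
next
  case False
  then show ?thesis unfolding rep_dist_def by (simp only: if_False)
qed

lemma rep_dist_le:
  assumes "0 \<le> B" "\<And>x. x \<in> K \<Longrightarrow> norm (\<pi> x - \<pi>' x) \<le> B"
  shows "rep_dist K \<pi> \<pi>' \<le> B"
proof -
  have "Sup (insert 0 ((\<lambda>x. norm (\<pi> x - \<pi>' x)) ` K)) \<le> B"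
    by (rule cSup_least) (use assms in blast)+
  then show ?thesis
    using assms(1) unfolding rep_dist_def by presburger
qed

lemma rep_dist_commute: "rep_dist K \<pi> \<pi>' = rep_dist K \<pi>' \<pi>"
  by (simp add: rep_dist_def norm_minus_commute)

lemma rep_dist_triangle:
  assumes "compact K" "\<pi> \<in> Rep" "\<pi>' \<in> Rep" "\<pi>'' \<in> Rep"
  shows "rep_dist K \<pi> \<pi>'' \<le> rep_dist K \<pi> \<pi>' + rep_dist K \<pi>' \<pi>''"
proof (rule rep_dist_le)
  fix x assume x: "x \<in> K"
  have "norm (\<pi> x - \<pi>'' x) \<le> norm (\<pi> x - \<pi>' x) + norm (\<pi>' x - \<pi>'' x)"
    using norm_triangle_ineq[of "\<pi> x - \<pi>' x" "\<pi>' x - \<pi>'' x"] by simp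
  also have "\<dots> \<le> rep_dist K \<pi> \<pi>' + rep_dist K \<pi>' \<pi>''"
    using assms x by (intro add_mono norm_diff_le_rep_dist)
  finally show "norm (\<pi> x - \<pi>'' x) \<le> rep_dist K \<pi> \<pi>' + rep_dist K \<pi>' \<pi>''" .
qed (simp add: rep_dist_nonneg assms)

text \<open>
  Contractivity enters twice: through equicontinuity for closedness, and through boundedness of
  the sequences \<open>p\<^sub>n(x)\<close> and \<open>q\<^sub>n(y)\<close> for products.
\<close>

lemma cstar_subalgebra_asymptotically_equal:
  fixes p q :: "nat \<Rightarrow> 'a::cstar_algebra \<Rightarrow> bop"
  assumes p: "\<And>n. p n \<in> Rep" and q: "\<And>n. q n \<in> Rep"
  shows "cstar_subalgebra {x. (\<lambda>n. norm (p n x - q n x)) \<longlonglongrightarrow> 0}" (is "cstar_subalgebra ?S")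
  unfolding cstar_subalgebra_def
proof (intro conjI ballI allI)
  have hom: "unital_star_hom (p n)" "unital_star_hom (q n)" for n
    using p[of n] q[of n] by (simp_all add: Rep_def)
  have add: "p n (x + y) = p n x + p n y" "q n (x + y) = q n x + q n y"
    and scale: "p n (c *\<^sub>C x) = c *\<^sub>C p n x" "q n (c *\<^sub>C x) = c *\<^sub>C q n x"
    and mult: "p n (x * y) = p n x * p n y" "q n (x * y) = q n x * q n y"
    and star: "p n (star x) = star (p n x)" "q n (star x) = star (q n x)" for n c x y
    using hom[of n] by (simp_all add: unital_star_hom_def)
  show "closed ?S"
  proof -
    have "x \<in> ?S" if x: "x \<in> closure ?S" for x
    proof -
      have "\<exists>N. \<forall>n\<ge>N. norm (norm (p n x - q n x) - 0) < e" if e: "e > 0" for e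
      proof -
        have "0 < e / 4" using e by simp
        with x have "\<exists>y\<in>?S. dist y x < e / 4"
          by (simp only: closure_approachable)
        then obtain y where y: "y \<in> ?S" "dist y x < e / 4"
          by (rule bexE)
        have "(\<lambda>n. norm (p n y - q n y)) \<longlonglongrightarrow> 0" using y(1) by simp
        from LIMSEQ_D[OF this half_gt_zero[OF e]]
        obtain N where N: "\<And>n. n \<ge> N \<Longrightarrow> norm (p n y - q n y) < e / 2"
          by auto
        have "norm (norm (p n x - q n x) - 0) < e" if "n \<ge> N" for n
          using Rep_diff_le[OF p q, of n x n y] N[OF that] y(2) by (simp add: dist_commute)
        then show ?thesis by blast
      qed
      then show ?thesis by (simp add: LIMSEQ_iff)
    qed
    then have "closure ?S \<subseteq> ?S" by (rule subsetI)
    then show ?thesis by (simp only: closure_subset_eq)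
  qed
  show "0 \<in> ?S"
    using unital_star_hom_diff[OF hom(1), of _ 0 0] unital_star_hom_diff[OF hom(2), of _ 0 0] by simp
  fix x assume x: "x \<in> ?S"
  show "c *\<^sub>C x \<in> ?S" for c
  proof -
    have "norm (p n (c *\<^sub>C x) - q n (c *\<^sub>C x)) = cmod c * norm (p n x - q n x)" for n
    proof -
      have "c *\<^sub>C (p n x - q n x) + c *\<^sub>C q n x = c *\<^sub>C p n x"
        by (simp flip: scaleC_add_right)
      then show ?thesis by (metis scale eq_diff_eq norm_scaleC)
    qed
    then show ?thesis
      using tendsto_mult_left[of _ 0 sequentially "cmod c"] x by simp
  qed
  show "star x \<in> ?S"
  proof -
    have "norm (p n (star x) - q n (star x)) = norm (p n x - q n x)" for n
    proof -
      have "star (p n x - q n x) + star (q n x) = star (p n x)"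
        by (simp flip: star_add)
      then show ?thesis by (metis star eq_diff_eq norm_star)
    qed
    then show ?thesis using x by simp
  qed
  fix y assume y: "y \<in> ?S"
  show "x + y \<in> ?S"
  proof -
    have le: "norm (p n (x + y) - q n (x + y)) \<le> norm (p n x - q n x) + norm (p n y - q n y)" for n
      using norm_triangle_ineq[of "p n x - q n x" "p n y - q n y"] by (simp add: add algebra_simps)
    have lim: "(\<lambda>n. norm (p n x - q n x) + norm (p n y - q n y)) \<longlonglongrightarrow> 0"
      by (rule tendsto_add_zero) (use x y in simp_all)
    have "(\<lambda>n. norm (p n (x + y) - q n (x + y))) \<longlonglongrightarrow> 0"
      by (rule Lim_null_comparison[OF _ lim]) (simp add: le)
    then show ?thesis by simp
  qed
  show "x * y \<in> ?S"
  proof -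
    have le: "norm (p n (x * y) - q n (x * y)) \<le> norm x * norm (p n y - q n y) + norm (p n x - q n x) * norm y" for n
    proof -
      have "p n (x * y) - q n (x * y) = p n x * (p n y - q n y) + (p n x - q n x) * q n y"
        by (simp add: mult algebra_simps)
      also have "norm \<dots> \<le> norm (p n x) * norm (p n y - q n y) + norm (p n x - q n x) * norm (q n y)"
        by (intro norm_triangle_mono norm_mult_ineq)
      also have "\<dots> \<le> norm x * norm (p n y - q n y) + norm (p n x - q n x) * norm y"
        by (intro add_mono mult_left_mono mult_right_mono Rep_norm_le p q) simp_all
      finally show ?thesis .
    qed
    have lim: "(\<lambda>n. norm x * norm (p n y - q n y) + norm (p n x - q n x) * norm y) \<longlonglongrightarrow> 0"
      by (intro tendsto_add_zero tendsto_mult_right_zero tendsto_mult_left_zero) (use x y in simp_all)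
    have "(\<lambda>n. norm (p n (x * y) - q n (x * y))) \<longlonglongrightarrow> 0"
      by (rule Lim_null_comparison[OF _ lim]) (simp add: le)
    then show ?thesis by simp
  qed
qed

text \<open>
  The right-hand side does not mention \<open>K\<close>: all compact generating sets define the same uniform
  structure on \<^const>\<open>Rep\<close>.
\<close>

lemma rep_dist_tendsto_0_iff:
  fixes p q :: "nat \<Rightarrow> 'a::cstar_algebra \<Rightarrow> bop"
  assumes K: "compact K" and gen: "generates_cstar K"
    and p: "\<And>n. p n \<in> Rep" and q: "\<And>n. q n \<in> Rep"
  shows "(\<lambda>n. rep_dist K (p n) (q n)) \<longlonglongrightarrow> 0 \<longleftrightarrow> (\<forall>x. (\<lambda>n. norm (p n x - q n x)) \<longlonglongrightarrow> 0)"
proof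
  assume lim: "(\<lambda>n. rep_dist K (p n) (q n)) \<longlonglongrightarrow> 0"
  let ?S = "{x. (\<lambda>n. norm (p n x - q n x)) \<longlonglongrightarrow> 0}"
  have "K \<subseteq> ?S"
  proof
    fix x assume "x \<in> K"
    then have "(\<lambda>n. norm (p n x - q n x)) \<longlonglongrightarrow> 0"
      using norm_diff_le_rep_dist[OF K p q] by (intro Lim_null_comparison[OF _ lim]) simp
    then show "x \<in> ?S" by simp
  qed
  moreover have "p n 1 = 1" "q n 1 = 1" for n
    using p[of n] q[of n] by (simp_all add: Rep_def unital_star_hom_def)
  ultimately have "cstar_subalgebra hull (K \<union> {1}) \<subseteq> ?S"
    by (intro hull_minimal cstar_subalgebra_asymptotically_equal p q) simp
  then show "\<forall>x. (\<lambda>n. norm (p n x - q n x)) \<longlonglongrightarrow> 0"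
    using gen unfolding generates_cstar_def by auto
next
  assume ptw: "\<forall>x. (\<lambda>n. norm (p n x - q n x)) \<longlonglongrightarrow> 0"
  have "\<exists>N. \<forall>n\<ge>N. norm (rep_dist K (p n) (q n) - 0) < e" if e: "e > 0" for e
  proof -
    obtain F where F: "finite F" "K \<subseteq> (\<Union>y\<in>F. ball y (e / 8))"
      using K e unfolding compact_eq_totally_bounded by (metis divide_pos_pos zero_less_numeral)
    have "\<forall>\<^sub>F n in sequentially. \<forall>y\<in>F. norm (p n y - q n y) < e / 4"
      using F(1) by (rule eventually_ball_finite)
        (use ptw e in \<open>auto intro!: order_tendstoD(2)[where y = 0]\<close>)
    then obtain N where N: "\<And>n y. n \<ge> N \<Longrightarrow> y \<in> F \<Longrightarrow> norm (p n y - q n y) < e / 4"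
      unfolding eventually_sequentially by blast
    have "rep_dist K (p n) (q n) \<le> e / 2" if n: "n \<ge> N" for n
    proof (rule rep_dist_le)
      fix x assume "x \<in> K"
      then obtain y where y: "y \<in> F" "dist x y < e / 8"
        using F(2) by (auto simp: dist_commute)
      show "norm (p n x - q n x) \<le> e / 2"
        using Rep_diff_le[OF p q, of n x n y] N[OF n y(1)] y(2) by simp
    qed (use e in simp)
    then have "norm (rep_dist K (p n) (q n) - 0) < e" if "n \<ge> N" for n
      using that e rep_dist_nonneg[OF K, of "p n" "q n"] by fastforce
    then show ?thesis by blast
  qed
  then show "(\<lambda>n. rep_dist K (p n) (q n)) \<longlonglongrightarrow> 0"
    by (simp add: LIMSEQ_iff)
qed

text \<open>
  Separation of points is the criterion above for constant sequences: representations that agree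
  on a generating set are equal.
\<close>

lemma Metric_space_rep_dist:
  fixes K :: "'a::cstar_algebra set"
  assumes K: "compact K" and gen: "generates_cstar K"
  shows "Metric_space Rep (rep_dist K)"
proof
  fix \<pi> \<pi>' :: "'a \<Rightarrow> bop"
  show "0 \<le> rep_dist K \<pi> \<pi>'" by (rule rep_dist_nonneg[OF K])
  show "rep_dist K \<pi> \<pi>' = rep_dist K \<pi>' \<pi>" by (rule rep_dist_commute)
  assume R: "\<pi> \<in> Rep" "\<pi>' \<in> Rep"
  show "rep_dist K \<pi> \<pi>' = 0 \<longleftrightarrow> \<pi> = \<pi>'"
    using rep_dist_tendsto_0_iff[OF K gen, of "\<lambda>_. \<pi>" "\<lambda>_. \<pi>'"] R
    by (simp add: LIMSEQ_const_iff fun_eq_iff)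
  show "rep_dist K \<pi> \<pi>'' \<le> rep_dist K \<pi> \<pi>' + rep_dist K \<pi>' \<pi>''" if "\<pi>'' \<in> Rep" for \<pi>''
    by (rule rep_dist_triangle[OF K R that])
qed


section \<open>Uniform continuity of the pullback\<close>

theorem theorem6p5:
  fixes K :: "'a::cstar_algebra set" and L :: "'b::cstar_algebra set"
    and \<alpha> :: "'a \<Rightarrow> 'b"
  assumes "separable_space (euclidean :: 'a topology)"
    and "separable_space (euclidean :: 'b topology)"
    and "compact K" and "generates_cstar K"
    and "compact L" and "generates_cstar L"
    and "unital_star_hom \<alpha>"
  shows "Metric_space Rep (rep_dist L) \<and> Metric_space Rep (rep_dist K) \<and>
    uniformly_continuous_map (metric (Rep, rep_dist L)) (metric (Rep, rep_dist K)) (\<lambda>\<pi>. \<pi> \<circ> \<alpha>)"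
proof (intro conjI)
  show L: "Metric_space Rep (rep_dist L)" and K: "Metric_space Rep (rep_dist K)"
    using assms by (auto intro: Metric_space_rep_dist)
  have pullback: "\<pi> \<circ> \<alpha> \<in> Rep" if "\<pi> \<in> Rep" for \<pi>
    using that assms(7) by (simp add: Rep_def unital_star_hom_compose)
  have "(\<lambda>n. rep_dist K (p n \<circ> \<alpha>) (q n \<circ> \<alpha>)) \<longlonglongrightarrow> 0"
    if p: "\<And>n. p n \<in> Rep" and q: "\<And>n. q n \<in> Rep"
      and lim: "(\<lambda>n. rep_dist L (p n) (q n)) \<longlonglongrightarrow> 0" for p q
  proof -
    have "\<forall>y. (\<lambda>n. norm (p n y - q n y)) \<longlonglongrightarrow> 0"
      using lim rep_dist_tendsto_0_iff[OF assms(5,6) p q] by simp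
    then show ?thesis
      using rep_dist_tendsto_0_iff[OF assms(3,4) pullback[OF p] pullback[OF q]] by simp
  qed
  then show "uniformly_continuous_map (metric (Rep, rep_dist L)) (metric (Rep, rep_dist K)) (\<lambda>\<pi>. \<pi> \<circ> \<alpha>)"
    unfolding uniformly_continuous_map_sequentially
    using pullback
    by (auto simp: Metric_space.mspace_metric[OF L] Metric_space.mdist_metric[OF L]
        Metric_space.mspace_metric[OF K] Metric_space.mdist_metric[OF K] image_subset_iff)
qed

end
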